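(* Let $F:\mathbb{P}^{n-1}\dashrightarrow\mathbb{P}^{n-1}$ be a rational map, over an arbitrary field $k$, defined by $n$ monomials of fixed degree (that is, $F=(x^{v_1},\ldots,x^{v_n})$ with $x^{v_1},\ldots,x^{v_n}\in k[x_1,\ldots,x_n]$ distinct monomials of the same degree $d\geq 1$, having no non-trivial common factor and such that every $x_i$ divides at least one of them). If $F$ is a Cremona map, then its inverse is also defined by monomials of fixed degree. Moreover, the degree as well as a set of monomials defining the inverse can be obtained explicitly in terms of the given set of monomials defining $F$.
   Context: For $\alpha=(a_1,\ldots,a_n)$ with non-negative integer entries, $x^\alpha=x_1^{a_1}\cdots x_n^{a_n}$. A tuple $(f_1,\ldots,f_n)$ of forms of the same degree, not all zero, defines a rational map $\mathbb{P}^{n-1}\dashrightarrow\mathbb{P}^{n-1}$; tuples $(f_1,\ldots,f_n)$ and $(gf_1,\ldots,gf_n)$, with $g$ a non-zero form, define the same rational map. A rational map $\mathbb{P}^{n-1}\dashrightarrow\mathbb{P}^{n-1}$ is called a Cremona map if it admits an inverse rational map with source $\mathbb{P}^{n-1}$. "Defined by monomials of fixed degree" means defined by a tuple of $n$ monomials all of the same degree; "the degree" in the last sentence is the common degree of the monomials defining the inverse. *)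

theory Defs
  imports "HOL-Analysis.Analysis" "HOL-Library.Poly_Mapping"
begin

text \<open>
  Projective space of dimension \<open>n - 1\<close> over the field \<open>'k\<close> has homogeneous coordinates indexed by
  the finite type \<open>'n\<close>, where \<open>n = CARD('n)\<close>; exponent vectors are finitely supported maps
  \<open>'n \<Rightarrow>\<^sub>0 nat\<close>, and polynomials are formal, so that \<open>'k\<close> may be finite.
\<close>

type_synonym 'n expo = "'n \<Rightarrow>\<^sub>0 nat"
type_synonym ('n, 'k) mpoly = "'n expo \<Rightarrow>\<^sub>0 'k"

definition mono_deg :: "'n::finite expo \<Rightarrow> nat" where
  "mono_deg \<alpha> = (\<Sum>i\<in>UNIV. Poly_Mapping.lookup \<alpha> i)"

definition monomial :: "'n expo \<Rightarrow> ('n, 'k::field) mpoly" where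
  "monomial \<alpha> = Poly_Mapping.single \<alpha> 1"

definition X :: "'n \<Rightarrow> ('n, 'k::field) mpoly" where
  "X i = monomial (Poly_Mapping.single i 1)"

text \<open>The zero polynomial is a form of every degree.\<close>

definition is_form :: "nat \<Rightarrow> ('n::finite, 'k::field) mpoly \<Rightarrow> bool" where
  "is_form e p \<longleftrightarrow> (\<forall>\<alpha>\<in>Poly_Mapping.keys p. mono_deg \<alpha> = e)"

definition subst :: "('n \<Rightarrow> ('n, 'k) mpoly) \<Rightarrow> ('n::finite, 'k::field) mpoly \<Rightarrow> ('n, 'k) mpoly" where
  "subst f p = (\<Sum>\<alpha>\<in>Poly_Mapping.keys p.
     Poly_Mapping.single 0 (Poly_Mapping.lookup p \<alpha>) * (\<Prod>i\<in>UNIV. f i ^ Poly_Mapping.lookup \<alpha> i))"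

definition form_tuple :: "('n::finite \<Rightarrow> ('n, 'k::field) mpoly) \<Rightarrow> bool" where
  "form_tuple f \<longleftrightarrow> (\<exists>e. \<forall>i. is_form e (f i)) \<and> (\<exists>i. f i \<noteq> 0)"

definition same_map ::
  "('n::finite \<Rightarrow> ('n, 'k::field) mpoly) \<Rightarrow> ('n \<Rightarrow> ('n, 'k) mpoly) \<Rightarrow> bool" where
  "same_map f f' \<longleftrightarrow> (\<exists>g g' e e'. g \<noteq> 0 \<and> g' \<noteq> 0 \<and> is_form e g \<and> is_form e' g' \<and>
     (\<forall>i. g * f i = g' * f' i))"

text \<open>
  On tuples of forms, \<open>same_map\<close> is the equivalence relation generated by identifying
  \<open>(f\<^sub>1, \<dots>, f\<^sub>n)\<close> with \<open>(g f\<^sub>1, \<dots>, g f\<^sub>n)\<close> for non-zero forms \<open>g\<close>.  A rational map is an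
  equivalence class.
\<close>

type_synonym ('n, 'k) rat_map = "('n \<Rightarrow> ('n, 'k) mpoly) set"

definition rat_map_of :: "('n::finite \<Rightarrow> ('n, 'k::field) mpoly) \<Rightarrow> ('n, 'k) rat_map" where
  "rat_map_of f = {f'. form_tuple f' \<and> same_map f f'}"

definition is_rat_map :: "('n::finite, 'k::field) rat_map \<Rightarrow> bool" where
  "is_rat_map F \<longleftrightarrow> (\<exists>f. form_tuple f \<and> F = rat_map_of f)"

definition id_map :: "('n::finite, 'k::field) rat_map" where
  "id_map = rat_map_of X"

text \<open>
  \<open>composes_to G F H\<close> says that the composite of \<open>F\<close> followed by \<open>G\<close> is defined and equals \<open>H\<close>.
  It is defined as soon as substituting some representative of \<open>F\<close> into some representative of
  \<open>G\<close> gives a tuple that is not identically zero.  Other representatives of \<open>G\<close> may vanish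
  identically on the image of \<open>F\<close>, but the non-zero composites all define the same map.
\<close>

definition composes_to ::
  "('n::finite, 'k::field) rat_map \<Rightarrow> ('n, 'k) rat_map \<Rightarrow> ('n, 'k) rat_map \<Rightarrow> bool" where
  "composes_to G F H \<longleftrightarrow> (\<exists>g\<in>G. \<exists>f\<in>F. (\<exists>i. subst f (g i) \<noteq> 0) \<and> H = rat_map_of (\<lambda>i. subst f (g i)))"

definition is_inverse :: "('n::finite, 'k::field) rat_map \<Rightarrow> ('n, 'k) rat_map \<Rightarrow> bool" where
  "is_inverse F G \<longleftrightarrow> is_rat_map F \<and> is_rat_map G \<and>
     composes_to G F id_map \<and> composes_to F G id_map"

definition is_cremona :: "('n::finite, 'k::field) rat_map \<Rightarrow> bool" where
  "is_cremona F \<longleftrightarrow> (\<exists>G. is_inverse F G)"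

text \<open>The exponent vectors of the given monomials are the columns of \<open>log_matrix\<close>.\<close>

definition log_matrix :: "('n::finite \<Rightarrow> 'n expo) \<Rightarrow> rat^'n^'n" where
  "log_matrix v = (\<chi> k i. of_nat (Poly_Mapping.lookup (v i) k))"

text \<open>
  With \<open>A = log_matrix v\<close>, let \<open>m k\<close> be the minimum of row \<open>k\<close> of \<open>A\<^sup>-\<^sup>1\<close>.  The \<open>i\<close>-th monomial of
  the inverse has exponent vector \<open>A\<^sup>-\<^sup>1 e\<^sub>i - m\<close>; these are the vectors with
  \<open>A \<beta>\<^sub>i = \<gamma> + e\<^sub>i\<close> for a common \<open>\<gamma>\<close>, normalised so that no variable divides all the monomials.
  Each column of \<open>A\<close> has sum \<open>d\<close>, so each column of \<open>A\<^sup>-\<^sup>1\<close> has sum \<open>1 / d\<close>, and the common degree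
  of the new monomials is \<open>1 / d - (\<Sum>k. m k)\<close>.  The entries of \<open>A\<^sup>-\<^sup>1\<close> are rational; it is part of
  the theorem that the resulting numbers are natural numbers.
\<close>

definition row_min :: "('n::finite \<Rightarrow> 'n expo) \<Rightarrow> 'n \<Rightarrow> rat" where
  "row_min v k = Min (range (\<lambda>j. matrix_inv (log_matrix v) $ k $ j))"

definition inverse_exponent :: "('n::finite \<Rightarrow> 'n expo) \<Rightarrow> 'n \<Rightarrow> 'n \<Rightarrow> rat" where
  "inverse_exponent v i k = matrix_inv (log_matrix v) $ k $ i - row_min v k"

definition inverse_degree :: "('n::finite \<Rightarrow> 'n expo) \<Rightarrow> nat \<Rightarrow> rat" where
  "inverse_degree v d = 1 / of_nat d - (\<Sum>k\<in>UNIV. row_min v k)"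

end

theory Submission
  imports Defs
begin

text \<open>
  Let \<open>A\<close> be the log matrix, so that \<open>x\<^sup>\<alpha>\<close> becomes \<open>x\<^bsup>A\<alpha>\<^esup>\<close> under substitution of the given monomials.
  If \<open>(g\<^sub>1, \<dots>, g\<^sub>n)\<close> inverts the map, then \<open>g\<^sub>i(x\<^sup>v) x\<^sub>j = g\<^sub>j(x\<^sup>v) x\<^sub>i\<close>.  Comparing supports yields
  exponents \<open>\<alpha>\<^sub>i\<close> occurring in \<open>g\<^sub>i\<close> and a vector \<open>\<gamma>\<close> with \<open>A \<alpha>\<^sub>i = \<gamma> + e\<^sub>i\<close> for all \<open>i\<close>.  Hence \<open>A\<close> is
  invertible and the differences of columns of \<open>A\<^sup>-\<^sup>1\<close> are the integer vectors \<open>\<alpha>\<^sub>i - \<alpha>\<^sub>j\<close>, so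
  subtracting the row minima makes \<open>A\<^sup>-\<^sup>1\<close> a matrix of natural numbers, whose columns are the
  exponents of a monomial inverse.  Any other inverse agrees with it because substituting the
  given monomials is injective on polynomials.
\<close>

subsection \<open>Polynomials over a finite set of variables form a domain\<close>

lemma poly_mapping_eq_sum_single:
  "p = (\<Sum>a\<in>Poly_Mapping.keys p. Poly_Mapping.single a (Poly_Mapping.lookup p a))"
  by (rule poly_mapping_eqI)
    (auto simp: lookup_sum lookup_single when_def sum.delta in_keys_iff)

lemma lookup_mult_keys:
  fixes p q :: "'a::monoid_add \<Rightarrow>\<^sub>0 'b::semiring_0"
  shows "Poly_Mapping.lookup (p * q) k =
    (\<Sum>a\<in>Poly_Mapping.keys p. \<Sum>b\<in>Poly_Mapping.keys q.
       Poly_Mapping.lookup p a * Poly_Mapping.lookup q b when a + b = k)"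
proof -
  have "p * q = (\<Sum>a\<in>Poly_Mapping.keys p. \<Sum>b\<in>Poly_Mapping.keys q.
      Poly_Mapping.single (a + b) (Poly_Mapping.lookup p a * Poly_Mapping.lookup q b))"
    by (subst poly_mapping_eq_sum_single[of p], subst poly_mapping_eq_sum_single[of q])
      (simp add: sum_product mult_single)
  then show ?thesis
    by (simp add: lookup_sum lookup_single)
qed

text \<open>Leading-term argument: if \<open>a\<close> and \<open>b\<close> maximise
  \<open>w\<close> on the two supports, only the pair \<open>(a, b)\<close> contributes to the
  coefficient at \<open>a + b\<close>. The order is borrowed through \<open>w\<close>.\<close>

lemma mult_nonzero_of_ordered_embedding:
  fixes p q :: "'a::comm_monoid_add \<Rightarrow>\<^sub>0 'b::semiring_no_zero_divisors"
    and w :: "'a \<Rightarrow> 'c::{linorder,ordered_cancel_ab_semigroup_add}"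
  assumes add: "\<And>a b. w (a + b) = w a + w b" and inj: "inj w"
    and p: "p \<noteq> 0" and q: "q \<noteq> 0"
  shows "p * q \<noteq> 0"
proof -
  have max_key: "\<exists>a\<in>Poly_Mapping.keys r. \<forall>b\<in>Poly_Mapping.keys r. w b \<le> w a"
    if "r \<noteq> 0" for r :: "'a \<Rightarrow>\<^sub>0 'b"
  proof -
    have "finite (w ` Poly_Mapping.keys r)" "w ` Poly_Mapping.keys r \<noteq> {}"
      using that by (auto simp: in_keys_iff poly_mapping_eq_iff fun_eq_iff)
    from Max_in[OF this] obtain a where "a \<in> Poly_Mapping.keys r" "Max (w ` Poly_Mapping.keys r) = w a"
      by auto
    then show ?thesis
      by (metis Max_ge finite_imageI finite_keys imageI)
  qed
  obtain a where a: "a \<in> Poly_Mapping.keys p" "\<And>a'. a' \<in> Poly_Mapping.keys p \<Longrightarrow> w a' \<le> w a"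
    using max_key[OF p] by auto
  obtain b where b: "b \<in> Poly_Mapping.keys q" "\<And>b'. b' \<in> Poly_Mapping.keys q \<Longrightarrow> w b' \<le> w b"
    using max_key[OF q] by auto
  have unique: "a' + b' = a + b \<longleftrightarrow> a' = a \<and> b' = b"
    if "a' \<in> Poly_Mapping.keys p" "b' \<in> Poly_Mapping.keys q" for a' b'
  proof
    assume "a' + b' = a + b"
    then have sum: "w a' + w b' = w a + w b"
      by (metis add)
    then have "\<not> w a' < w a" "\<not> w b' < w b"
      using a(2)[OF that(1)] b(2)[OF that(2)] add_less_le_mono add_le_less_mono
      by (metis order_less_irrefl)+
    then have "w a' = w a" "w b' = w b"
      using a(2)[OF that(1)] b(2)[OF that(2)] by auto
    then show "a' = a \<and> b' = b"
      using inj by (simp add: inj_eq)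
  qed simp
  have "Poly_Mapping.lookup (p * q) (a + b) =
    (\<Sum>a'\<in>Poly_Mapping.keys p. \<Sum>b'\<in>Poly_Mapping.keys q.
       (if a' = a then Poly_Mapping.lookup p a else 0) * (if b' = b then Poly_Mapping.lookup q b else 0))"
    unfolding lookup_mult_keys
    by (intro sum.cong refl) (auto simp: when_def unique)
  also have "\<dots> = Poly_Mapping.lookup p a * Poly_Mapping.lookup q b"
    using a(1) b(1) by (simp flip: sum_product)
  finally show ?thesis
    using a(1) b(1) by (auto simp: in_keys_iff)
qed

text \<open>
  The library instance \<open>poly_mapping :: idom\<close> needs ordered exponents, while the variables here
  are merely a finite type.  Integer polynomials, ordered by their leading coefficients, supply
  the order.
\<close>

lemma mpoly_no_zero_divisors:
  fixes p q :: "('n::finite, 'k::field) mpoly"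
  assumes "p \<noteq> 0" "q \<noteq> 0"
  shows "p * q \<noteq> 0"
proof -
  obtain idx :: "'n \<Rightarrow> nat" where idx: "inj idx"
    using finite_imp_inj_to_nat_seg[of "UNIV :: 'n set"] by auto
  define w :: "'n expo \<Rightarrow> int poly"
    where "w \<alpha> = (\<Sum>i\<in>UNIV. Polynomial.monom (of_nat (Poly_Mapping.lookup \<alpha> i)) (idx i))" for \<alpha>
  have "w (\<alpha> + \<beta>) = w \<alpha> + w \<beta>" for \<alpha> \<beta>
    by (simp add: w_def lookup_add add_monom flip: sum.distrib)
  moreover have "Polynomial.coeff (w \<alpha>) (idx j) = of_nat (Poly_Mapping.lookup \<alpha> j)" for \<alpha> j
    using idx by (simp add: w_def Polynomial.coeff_sum inj_eq eq_commute[of _ j])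
  then have "inj w"
    by (intro injI poly_mapping_eqI) (metis of_nat_eq_iff)
  ultimately show ?thesis
    using mult_nonzero_of_ordered_embedding assms by blast
qed

lemma mpoly_mult_left_cancel:
  fixes p :: "('n::finite, 'k::field) mpoly"
  assumes "p \<noteq> 0" "p * q = p * r"
  shows "q = r"
  using mpoly_no_zero_divisors[of p "q - r"] assms by (auto simp: right_diff_distrib)

lemma mpoly_power_nonzero:
  fixes p :: "('n::finite, 'k::field) mpoly"
  shows "p \<noteq> 0 \<Longrightarrow> p ^ m \<noteq> 0"
  by (induction m) (auto simp: mpoly_no_zero_divisors)

subsection \<open>Monomials and forms\<close>

lemma monomial_nonzero [simp]: "monomial \<alpha> \<noteq> (0 :: ('n, 'k::field) mpoly)"
  by (metis lookup_single_eq lookup_zero monomial_def zero_neq_one)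

lemma monomial_0: "monomial 0 = 1"
  by (simp add: monomial_def)

lemma monomial_add: "monomial (\<alpha> + \<beta>) = monomial \<alpha> * monomial \<beta>"
  by (simp add: monomial_def mult_single)

lemma monomial_sum: "monomial (\<Sum>i\<in>I. u i) = (\<Prod>i\<in>I. monomial (u i))"
  by (induction I rule: infinite_finite_induct) (simp_all add: monomial_0 monomial_add)

lemma is_form_monomial: "is_form (mono_deg \<alpha>) (monomial \<alpha>)"
  by (simp add: is_form_def monomial_def)

lemma mono_deg_add: "mono_deg (\<alpha> + \<beta>) = mono_deg \<alpha> + mono_deg \<beta>"
  by (simp add: mono_deg_def lookup_add sum.distrib)

lemma mono_deg_single: "mono_deg (Poly_Mapping.single i m) = m"
  by (simp add: mono_deg_def lookup_single when_def)

lemma is_form_mult: "is_form e p \<Longrightarrow> is_form e' q \<Longrightarrow> is_form (e + e') (p * q)"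
  using keys_mult[of p q] by (fastforce simp: is_form_def mono_deg_add)

lemma lookup_mult_monomial:
  "Poly_Mapping.lookup (p * monomial \<beta>) (\<alpha> + \<beta>) = Poly_Mapping.lookup p \<alpha>"
  by (simp add: lookup_mult_keys monomial_def when_def in_keys_iff)

lemma form_tuple_monomial:
  assumes "\<forall>i. mono_deg (u i) = e"
  shows "form_tuple (\<lambda>i. monomial (u i))"
  unfolding form_tuple_def using assms is_form_monomial[of "u _"]
  by (metis monomial_nonzero)

subsection \<open>Equality of rational maps\<close>

lemma same_map_refl: "same_map f f"
proof -
  have "is_form 0 (1 :: ('n::finite, 'k::field) mpoly)"
    by (simp add: is_form_def mono_deg_def)
  then show ?thesis
    unfolding same_map_def by (intro exI[of _ 1] exI[of _ 0]) simp
qed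

lemma same_map_sym: "same_map f f' \<Longrightarrow> same_map f' f"
  unfolding same_map_def by metis

text \<open>The multipliers combine crosswise; the products stay non-zero because polynomials form a
  domain.\<close>

lemma same_map_trans:
  assumes "same_map f f'" "same_map f' f''"
  shows "same_map f f''"
proof -
  obtain g g' e e' where g: "g \<noteq> 0" "g' \<noteq> 0" "is_form e g" "is_form e' g'" "\<And>i. g * f i = g' * f' i"
    using assms(1) by (auto simp: same_map_def)
  obtain h h' a a' where h: "h \<noteq> 0" "h' \<noteq> 0" "is_form a h" "is_form a' h'" "\<And>i. h * f' i = h' * f'' i"
    using assms(2) by (auto simp: same_map_def)
  have "(h * g) * f i = (g' * h') * f'' i" for i
  proof -
    have "(h * g) * f i = g' * (h * f' i)"
      unfolding mult.assoc g(5) by (rule mult.left_commute)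
    then show ?thesis
      unfolding mult.assoc h(5) .
  qed
  moreover have "h * g \<noteq> 0" "g' * h' \<noteq> 0" "is_form (a + e) (h * g)" "is_form (e' + a') (g' * h')"
    using g h by (auto simp: mpoly_no_zero_divisors is_form_mult)
  ultimately show ?thesis
    unfolding same_map_def by blast
qed

lemma rat_map_of_eqI: "same_map f f' \<Longrightarrow> rat_map_of f = rat_map_of f'"
  unfolding rat_map_of_def using same_map_trans same_map_sym by blast

text \<open>As a tuple of forms, \<open>f'\<close> lies in its own class and hence in that of
  \<open>f\<close>.\<close>

lemma rat_map_of_eqD: "form_tuple f' \<Longrightarrow> rat_map_of f = rat_map_of f' \<Longrightarrow> same_map f f'"
  unfolding rat_map_of_def using same_map_refl by blast

text \<open>Equality in projective space means that all \<open>2 \<times> 2\<close> minors vanish.\<close>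

lemma same_map_of_minors:
  assumes "form_tuple f" "form_tuple f'"
    and minors: "\<And>i j. f i * f' j = f j * f' i" and nonzero: "\<And>i. f' i \<noteq> 0"
  shows "same_map f f'"
proof -
  obtain i where i: "f i \<noteq> 0"
    using assms(1) by (auto simp: form_tuple_def)
  \<comment> \<open>The coordinates \<open>f' i\<close> and \<open>f i\<close> themselves serve as
    the two multipliers.\<close>
  have "f' i * f j = f i * f' j" for j
    using minors[of j i] by (simp add: mult.commute)
  with i nonzero[of i] show ?thesis
    using assms(1,2) unfolding form_tuple_def same_map_def by blast
qed

lemma X_nonzero [simp]: "X i \<noteq> (0 :: ('n, 'k::field) mpoly)"
  by (simp add: X_def)

lemma form_tuple_X: "form_tuple X"
  unfolding X_def[abs_def] using mono_deg_single by (intro form_tuple_monomial) blast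

text \<open>The unknown multipliers cancel in a domain, and no coordinate vanishes because no
  \<open>X i\<close> does.\<close>

lemma minors_of_same_map_X:
  assumes "same_map f X"
  shows "f i * X j = f j * X i" "f i \<noteq> 0"
proof -
  obtain g g' where g: "g \<noteq> 0" "g' \<noteq> 0" "\<And>i. g * f i = g' * X i"
    using assms by (auto simp: same_map_def)
  have "g * (f i * X j) = g * (f j * X i)"
    unfolding mult.assoc[symmetric] g(3) by (simp only: ac_simps)
  then show "f i * X j = f j * X i"
    by (rule mpoly_mult_left_cancel[OF g(1)])
  show "f i \<noteq> 0"
    using g(3)[of i] mpoly_no_zero_divisors[OF g(2) X_nonzero[of i]] by auto
qed

text \<open>The hypothesis says, without subtraction, that \<open>w i\<close> minus the
  \<open>i\<close>-th unit vector does not depend on \<open>i\<close>. Both composites are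
  recognised as the identity in this way.\<close>

lemma monomial_map_eq_id:
  assumes shift: "\<And>i j. w i + Poly_Mapping.single j 1 = w j + Poly_Mapping.single i 1"
  shows "rat_map_of (\<lambda>i. monomial (w i)) = id_map"
  unfolding id_map_def
proof (intro rat_map_of_eqI same_map_of_minors form_tuple_X form_tuple_monomial allI)
  fix i j
  show "mono_deg (w i) = mono_deg (w undefined)"
    using arg_cong[OF shift[of i undefined], of mono_deg]
    by (simp add: mono_deg_add mono_deg_single)
  show "monomial (w i) * X j = monomial (w j) * X i"
    by (metis X_def monomial_add shift)
qed simp

subsection \<open>Substitution of monomials\<close>

text \<open>The log matrix acting on exponents; the inner sum of a constant is the natural multiple
  of \<open>v i\<close>.\<close>

definition expo_subst :: "('n::finite \<Rightarrow> 'n expo) \<Rightarrow> 'n expo \<Rightarrow> 'n expo" where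
  "expo_subst v \<alpha> = (\<Sum>i\<in>UNIV. \<Sum>_<Poly_Mapping.lookup \<alpha> i. v i)"

lemma lookup_expo_subst:
  "Poly_Mapping.lookup (expo_subst v \<alpha>) k =
    (\<Sum>i\<in>UNIV. Poly_Mapping.lookup \<alpha> i * Poly_Mapping.lookup (v i) k)"
  by (simp add: expo_subst_def lookup_sum)

lemma expo_subst_add: "expo_subst v (\<alpha> + \<beta>) = expo_subst v \<alpha> + expo_subst v \<beta>"
  by (rule poly_mapping_eqI)
    (simp add: lookup_expo_subst lookup_add sum.distrib distrib_right)

lemma subst_monomials:
  fixes p :: "('n::finite, 'k::field) mpoly"
  shows "subst (\<lambda>i. monomial (v i)) p =
    (\<Sum>\<alpha>\<in>Poly_Mapping.keys p. Poly_Mapping.single (expo_subst v \<alpha>) (Poly_Mapping.lookup p \<alpha>))"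
proof -
  have "monomial (v i) ^ m = (monomial (\<Sum>_<m. v i) :: ('n, 'k) mpoly)" for i m
    by (simp add: monomial_sum)
  then have "(\<Prod>i\<in>UNIV. monomial (v i) ^ Poly_Mapping.lookup \<alpha> i) =
      (monomial (expo_subst v \<alpha>) :: ('n, 'k) mpoly)" for \<alpha>
    by (simp add: expo_subst_def monomial_sum)
  then show ?thesis
    unfolding subst_def by (simp only:) (simp add: monomial_def mult_single)
qed

lemma subst_monomials_monomial:
  "subst (\<lambda>i. monomial (v i)) (monomial \<alpha>) = monomial (expo_subst v \<alpha>)"
  unfolding subst_monomials by (simp add: monomial_def)

text \<open>Terms may merge or cancel, but no new exponents arise. This is available before the log
  matrix is known to be invertible.\<close>

lemma keys_subst_monomials:
  assumes "\<mu> \<in> Poly_Mapping.keys (subst (\<lambda>i. monomial (v i)) p)"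
  obtains \<alpha> where "\<alpha> \<in> Poly_Mapping.keys p" "\<mu> = expo_subst v \<alpha>"
proof -
  have "\<mu> \<in> (\<Union>\<alpha>\<in>Poly_Mapping.keys p.
      Poly_Mapping.keys (Poly_Mapping.single (expo_subst v \<alpha>) (Poly_Mapping.lookup p \<alpha>)))"
    using assms keys_sum unfolding subst_monomials by (rule subsetD[rotated])
  then show thesis
    using that by (auto split: if_splits)
qed

text \<open>Injectivity on exponents keeps distinct terms apart.\<close>

lemma lookup_subst_monomials:
  assumes "inj (expo_subst v)"
  shows "Poly_Mapping.lookup (subst (\<lambda>i. monomial (v i)) p) (expo_subst v \<alpha>) = Poly_Mapping.lookup p \<alpha>"
proof -
  have "Poly_Mapping.lookup (subst (\<lambda>i. monomial (v i)) p) (expo_subst v \<alpha>) =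
      (\<Sum>\<alpha>'\<in>Poly_Mapping.keys p. if \<alpha>' = \<alpha> then Poly_Mapping.lookup p \<alpha>' else 0)"
    unfolding subst_monomials
    by (simp add: lookup_sum lookup_single when_def inj_eq[OF assms])
  also have "\<dots> = Poly_Mapping.lookup p \<alpha>"
    by (simp add: in_keys_iff)
  finally show ?thesis .
qed

lemma subst_monomials_injD:
  assumes "inj (expo_subst v)" "subst (\<lambda>i. monomial (v i)) p = subst (\<lambda>i. monomial (v i)) q"
  shows "p = q"
  by (rule poly_mapping_eqI) (metis assms lookup_subst_monomials)

text \<open>A monomial factor merely translates the support, so terms can be matched one by
  one.\<close>

lemma subst_monomials_mult_monomial:
  "subst (\<lambda>i. monomial (v i)) (p * monomial \<beta>) =
    subst (\<lambda>i. monomial (v i)) p * monomial (expo_subst v \<beta>)"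
proof -
  have "Poly_Mapping.keys (p * monomial \<beta>) = (\<lambda>\<alpha>. \<alpha> + \<beta>) ` Poly_Mapping.keys p"
  proof
    show "Poly_Mapping.keys (p * monomial \<beta>) \<subseteq> (\<lambda>\<alpha>. \<alpha> + \<beta>) ` Poly_Mapping.keys p"
      using keys_mult[of p "monomial \<beta>"] by (auto simp: monomial_def)
    show "(\<lambda>\<alpha>. \<alpha> + \<beta>) ` Poly_Mapping.keys p \<subseteq> Poly_Mapping.keys (p * monomial \<beta>)"
      by (auto simp: in_keys_iff lookup_mult_monomial)
  qed
  then show ?thesis
    by (simp add: subst_monomials sum.reindex lookup_mult_monomial expo_subst_add sum_distrib_right)
      (simp add: monomial_def mult_single)
qed

text \<open>Each term of \<open>p\<close> picks up \<open>h\<close> once per unit of its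
  degree.\<close>

lemma subst_form_scale:
  assumes "is_form e p"
  shows "subst (\<lambda>i. h * f i) p = h ^ e * subst f p"
proof -
  have "(\<Prod>i\<in>UNIV. (h * f i) ^ Poly_Mapping.lookup \<alpha> i) =
      h ^ e * (\<Prod>i\<in>UNIV. f i ^ Poly_Mapping.lookup \<alpha> i)" if "\<alpha> \<in> Poly_Mapping.keys p" for \<alpha>
    using that assms
    by (auto simp: power_mult_distrib prod.distrib is_form_def mono_deg_def simp flip: power_sum)
  then show ?thesis
    by (simp add: subst_def sum_distrib_left mult.left_commute)
qed

text \<open>
  The representative of \<open>F\<close> used in the composite may be replaced by the monomial one, because
  rescaling the coordinates by forms rescales the composite by powers of them.
\<close>

lemma composes_to_id_representative:
  fixes f\<^sub>0 :: "'n::finite \<Rightarrow> ('n, 'k::field) mpoly"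
  assumes "is_rat_map G" "composes_to G (rat_map_of f\<^sub>0) id_map"
  obtains g where "G = rat_map_of g" "form_tuple g"
    "\<And>i j. subst f\<^sub>0 (g i) * X j = subst f\<^sub>0 (g j) * X i" "\<And>i. subst f\<^sub>0 (g i) \<noteq> 0"
proof -
  obtain g f where g: "g \<in> G" and f: "f \<in> rat_map_of f\<^sub>0"
    and id: "(id_map :: ('n, 'k) rat_map) = rat_map_of (\<lambda>i. subst f (g i))"
    using assms(2) by (auto simp: composes_to_def)
  obtain g' where "G = rat_map_of g'"
    using assms(1) by (auto simp: is_rat_map_def)
  \<comment> \<open>Any member of a class determines it, so the tuple \<open>g\<close> used in the
    composite represents \<open>G\<close>.\<close>
  with g have "form_tuple g" and G: "G = rat_map_of g"
    using rat_map_of_eqI[of g' g] by (auto simp: rat_map_of_def[of g'])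
  from \<open>form_tuple g\<close> obtain e where e: "\<And>i. is_form e (g i)"
    by (auto simp: form_tuple_def)
  have X: "same_map (\<lambda>i. subst f (g i)) X"
    using id form_tuple_X rat_map_of_eqD unfolding id_map_def by metis
  obtain h h' where h: "h \<noteq> 0" "h' \<noteq> 0" "\<And>i. h * f\<^sub>0 i = h' * f i"
    using f by (auto simp: rat_map_of_def same_map_def)
  have scale: "h ^ e * subst f\<^sub>0 (g i) = h' ^ e * subst f (g i)" for i
    using subst_form_scale[OF e, of h f\<^sub>0] subst_form_scale[OF e, of h' f] h(3) by simp
  have he: "h ^ e \<noteq> 0" "h' ^ e \<noteq> 0"
    using h by (simp_all add: mpoly_power_nonzero)
  have "h ^ e * (subst f\<^sub>0 (g i) * X j) = h ^ e * (subst f\<^sub>0 (g j) * X i)" for i j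
    unfolding mult.assoc[symmetric] scale
    by (simp only: mult.assoc minors_of_same_map_X(1)[OF X, of i j])
  then have "subst f\<^sub>0 (g i) * X j = subst f\<^sub>0 (g j) * X i" for i j
    using mpoly_mult_left_cancel[OF he(1)] by blast
  moreover have "subst f\<^sub>0 (g i) \<noteq> 0" for i
    using scale[of i] mpoly_no_zero_divisors[OF he(2) minors_of_same_map_X(2)[OF X, of i]] by auto
  ultimately show thesis
    using that G \<open>form_tuple g\<close> by blast
qed

subsection \<open>The log matrix\<close>

definition expo_vec :: "'n::finite expo \<Rightarrow> rat^'n" where
  "expo_vec \<alpha> = (\<chi> k. of_nat (Poly_Mapping.lookup \<alpha> k))"

lemma expo_vec_eq_iff: "expo_vec \<alpha> = expo_vec \<beta> \<longleftrightarrow> \<alpha> = \<beta>"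
  by (auto simp: expo_vec_def vec_eq_iff intro: poly_mapping_eqI)

lemma expo_vec_add: "expo_vec (\<alpha> + \<beta>) = expo_vec \<alpha> + expo_vec \<beta>"
  by (simp add: expo_vec_def vec_eq_iff lookup_add)

lemma expo_vec_single: "expo_vec (Poly_Mapping.single i m) = axis i (of_nat m)"
  by (simp add: expo_vec_def vec_eq_iff lookup_single axis_def when_def)

lemma expo_vec_expo_subst: "expo_vec (expo_subst v \<alpha>) = log_matrix v *v expo_vec \<alpha>"
  by (simp add: expo_vec_def vec_eq_iff lookup_expo_subst log_matrix_def matrix_vector_mult_def
      mult.commute)

lemma inj_expo_subst:
  assumes "invertible (log_matrix v)"
  shows "inj (expo_subst v)"
proof (rule injI)
  fix \<alpha> \<beta>
  assume "expo_subst v \<alpha> = expo_subst v \<beta>"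
  then have "log_matrix v *v expo_vec \<alpha> = log_matrix v *v expo_vec \<beta>"
    by (metis expo_vec_expo_subst)
  moreover have "inj ((*v) (log_matrix v))"
    using assms by (meson invertible_left_inverse matrix_left_invertible_injective)
  ultimately show "\<alpha> = \<beta>"
    by (simp add: inj_eq expo_vec_eq_iff)
qed

text \<open>One exponent \<mu> of the coordinate at a fixed \<open>i\<^sub>0\<close> is followed
  through the minors with each \<open>j\<close>. Multiplying by a variable only shifts supports, so
  \<mu> shifted by \<open>j\<close> reappears on the other side and yields
  \<open>\<alpha> j\<close>; any two indices are then compared through \<mu>.\<close>

lemma exponents_of_inverse:
  assumes minors: "\<And>i j. subst (\<lambda>i. monomial (v i)) (g i) * X j = subst (\<lambda>i. monomial (v i)) (g j) * X i"
    and nonzero: "\<And>i. subst (\<lambda>i. monomial (v i)) (g i) \<noteq> (0 :: ('n::finite, 'k::field) mpoly)"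
  obtains \<alpha> where "\<And>i j. expo_subst v (\<alpha> i) + Poly_Mapping.single j 1 =
      expo_subst v (\<alpha> j) + Poly_Mapping.single i 1"
proof -
  fix i\<^sub>0 :: 'n
  define s where "s i = subst (\<lambda>i. monomial (v i)) (g i)" for i
  obtain \<mu> where \<mu>: "\<mu> \<in> Poly_Mapping.keys (s i\<^sub>0)"
    using nonzero[of i\<^sub>0] unfolding s_def by (metis all_not_in_conv keys_eq_empty)
  have "\<exists>\<alpha>. \<mu> + Poly_Mapping.single j 1 = expo_subst v \<alpha> + Poly_Mapping.single i\<^sub>0 1" for j
  proof -
    have "Poly_Mapping.lookup (s i\<^sub>0 * X j) (\<mu> + Poly_Mapping.single j 1) \<noteq> 0"
      using \<mu> by (simp add: X_def lookup_mult_monomial in_keys_iff)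
    then have "\<mu> + Poly_Mapping.single j 1 \<in> Poly_Mapping.keys (s j * X i\<^sub>0)"
      using minors[of i\<^sub>0 j] by (simp add: s_def in_keys_iff)
    then obtain \<nu> where "\<nu> \<in> Poly_Mapping.keys (s j)"
      "\<mu> + Poly_Mapping.single j 1 = \<nu> + Poly_Mapping.single i\<^sub>0 1"
      using keys_mult[of "s j" "X i\<^sub>0"] by (auto simp: X_def monomial_def)
    then show ?thesis
      unfolding s_def by (metis keys_subst_monomials)
  qed
  then obtain \<alpha> where \<alpha>: "\<And>j. \<mu> + Poly_Mapping.single j 1 = expo_subst v (\<alpha> j) + Poly_Mapping.single i\<^sub>0 1"
    by metis
  have "expo_subst v (\<alpha> i) + Poly_Mapping.single j 1 = expo_subst v (\<alpha> j) + Poly_Mapping.single i 1"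
    for i j
  proof -
    have "expo_subst v (\<alpha> i) + Poly_Mapping.single j 1 + Poly_Mapping.single i\<^sub>0 1 =
        \<mu> + Poly_Mapping.single i 1 + Poly_Mapping.single j 1"
      unfolding \<alpha> by (simp only: ac_simps)
    also have "\<dots> = \<mu> + Poly_Mapping.single j 1 + Poly_Mapping.single i 1"
      by (simp only: ac_simps)
    also have "\<dots> = expo_subst v (\<alpha> j) + Poly_Mapping.single i 1 + Poly_Mapping.single i\<^sub>0 1"
      unfolding \<alpha> by (simp only: ac_simps)
    finally show ?thesis
      by simp
  qed
  then show thesis
    using that by blast
qed

text \<open>The adjoint identity for the standard bilinear form, spelled out as sums because it is
  applied to rational entries.\<close>

lemma sum_mult_matrix_vector:
  "(\<Sum>k\<in>UNIV. z $ k * (A *v x) $ k) = (\<Sum>i\<in>UNIV. (transpose A *v z) $ i * x $ i)"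
  for A :: "'a::comm_semiring_1^'n^'m"
  unfolding matrix_vector_mult_def transpose_def
  by (simp add: sum_distrib_left sum_distrib_right) (subst sum.swap, simp add: mult_ac)

lemma matrix_vector_mult_axis_nth: "(A *v axis i 1) $ k = A $ k $ i"
  for A :: "'a::semiring_1^'n^'m"
  by (simp add: matrix_vector_mult_def axis_def if_distrib[of "(*) _"] cong: if_cong)

lemma sum_log_matrix_column:
  assumes "\<forall>i. mono_deg (v i) = d"
  shows "(\<Sum>k\<in>UNIV. log_matrix v $ k $ i) = of_nat d"
  using assms by (simp add: log_matrix_def mono_deg_def flip: of_nat_sum)

text \<open>
  A vector orthogonal to the image of the log matrix is orthogonal to all \<open>e\<^sub>i - e\<^sub>j\<close>, hence
  constant; as the columns have sum \<open>d \<noteq> 0\<close>, it vanishes.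
\<close>

lemma invertible_log_matrix:
  fixes v :: "'n::finite \<Rightarrow> 'n expo"
  assumes degree: "\<forall>i. mono_deg (v i) = d" and "d \<ge> 1"
    and \<alpha>: "\<And>i j. expo_subst v (\<alpha> i) + Poly_Mapping.single j 1 =
      expo_subst v (\<alpha> j) + Poly_Mapping.single i 1"
  shows "invertible (log_matrix v)"
proof -
  let ?A = "log_matrix v"
  have "z = 0" if z: "transpose ?A *v z = 0" for z
  proof -
    have orth: "(\<Sum>k\<in>UNIV. z $ k * (?A *v x) $ k) = 0" for x
      unfolding sum_mult_matrix_vector z by simp
    have "z $ j = z $ i" for i j
    proof -
      have "?A *v expo_vec (\<alpha> i) + axis j 1 = ?A *v expo_vec (\<alpha> j) + axis i 1"
        using arg_cong[OF \<alpha>[of i j], of expo_vec]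
        by (simp add: expo_vec_add expo_vec_single expo_vec_expo_subst)
      \<comment> \<open>Pairing with \<open>z\<close> kills the images of \<open>?A\<close> and
        leaves \<open>z $ j = z $ i\<close>.\<close>
      then have "(\<Sum>k\<in>UNIV. z $ k * (?A *v expo_vec (\<alpha> i) + axis j 1) $ k) =
          (\<Sum>k\<in>UNIV. z $ k * (?A *v expo_vec (\<alpha> j) + axis i 1) $ k)"
        by simp
      then show ?thesis
        by (simp add: distrib_left sum.distrib orth axis_def if_distrib[of "(*) _"] cong: if_cong)
    qed
    then have const: "z $ k = z $ i" for i k
      by blast
    have "z $ i = 0" for i
    proof -
      have "0 = (\<Sum>k\<in>UNIV. z $ k * (?A *v axis i 1) $ k)"
        by (simp only: orth)
      also have "\<dots> = (\<Sum>k\<in>UNIV. z $ i * ?A $ k $ i)"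
      proof (intro sum.cong refl)
        show "z $ k * (?A *v axis i 1) $ k = z $ i * ?A $ k $ i" for k
          by (simp only: const[of k i] matrix_vector_mult_axis_nth)
      qed
      also have "\<dots> = z $ i * of_nat d"
        by (simp add: sum_log_matrix_column[OF degree] flip: sum_distrib_left)
      finally show ?thesis
        using \<open>d \<ge> 1\<close> by simp
    qed
    then show ?thesis
      by (simp add: vec_eq_iff)
  qed
  then have "\<exists>B. B ** transpose ?A = mat 1"
    by (simp add: matrix_left_invertible_ker)
  \<comment> \<open>A left inverse of the transpose gives a right inverse of \<open>?A\<close>,
    which suffices for a square matrix.\<close>
  then show ?thesis
    by (simp add: left_invertible_transpose invertible_right_inverse)
qed

theorem theorem4p2:
  fixes v :: "'n::finite \<Rightarrow> 'n expo"
    and d :: nat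
    and F :: "('n, 'k::field) rat_map"
  assumes distinct: "inj v"
    and degree: "\<forall>i. mono_deg (v i) = d"
    and d_pos: "d \<ge> 1"
    and no_common_factor: "\<forall>g :: ('n, 'k) mpoly. (\<forall>i. g dvd monomial (v i)) \<longrightarrow> g dvd 1"
    and all_variables: "\<forall>j. \<exists>i. (X j :: ('n, 'k) mpoly) dvd monomial (v i)"
    and F: "F = rat_map_of (\<lambda>i. monomial (v i))"
    and cremona: "is_cremona F"
  shows "invertible (log_matrix v) \<and>
    (\<exists>(\<beta> :: 'n \<Rightarrow> 'n expo) \<delta>.
       (\<forall>i. mono_deg (\<beta> i) = \<delta>) \<and>
       (\<forall>G. is_inverse F G \<longleftrightarrow> G = rat_map_of (\<lambda>i. monomial (\<beta> i))) \<and>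
       (\<forall>i k. of_nat (Poly_Mapping.lookup (\<beta> i) k) = inverse_exponent v i k) \<and>
       of_nat \<delta> = inverse_degree v d)"
proof -
  let ?A = "log_matrix v" and ?B = "matrix_inv (log_matrix v)"
  let ?x = "\<lambda>i. monomial (v i) :: ('n, 'k) mpoly"

  \<comment> \<open>Invertibility of the log matrix\<close>
  obtain G\<^sub>0 where "is_inverse F G\<^sub>0"
    using cremona by (auto simp: is_cremona_def)
  then have "is_rat_map G\<^sub>0" "composes_to G\<^sub>0 (rat_map_of ?x) id_map"
    by (auto simp: is_inverse_def F)
  then obtain g\<^sub>0 where "\<And>i j. subst ?x (g\<^sub>0 i) * X j = subst ?x (g\<^sub>0 j) * X i"
    "\<And>i. subst ?x (g\<^sub>0 i) \<noteq> 0"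
    by (rule composes_to_id_representative) blast
  then obtain \<alpha> where \<alpha>: "\<And>i j. expo_subst v (\<alpha> i) + Poly_Mapping.single j 1 =
      expo_subst v (\<alpha> j) + Poly_Mapping.single i 1"
    by (rule exponents_of_inverse) blast
  have inv: "invertible ?A"
    using invertible_log_matrix[OF degree d_pos \<alpha>] .
  then have AB: "?A ** ?B = mat 1" and BA: "?B ** ?A = mat 1"
    using someI_ex[OF inv[unfolded invertible_def]] by (simp_all add: matrix_inv_def)

  \<comment> \<open>Integrality of the new exponents\<close>
  have "of_nat (Poly_Mapping.lookup (\<alpha> i) k) + ?B $ k $ j =
      of_nat (Poly_Mapping.lookup (\<alpha> j) k) + ?B $ k $ i" for i j k
  proof -
    have "?A *v expo_vec (\<alpha> i) + axis j 1 = ?A *v expo_vec (\<alpha> j) + axis i 1"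
      using arg_cong[OF \<alpha>[of i j], of expo_vec]
      by (simp add: expo_vec_add expo_vec_single expo_vec_expo_subst)
    then have "?B *v (?A *v expo_vec (\<alpha> i) + axis j 1) = ?B *v (?A *v expo_vec (\<alpha> j) + axis i 1)"
      by simp
    then show ?thesis
      by (simp add: matrix_vector_right_distrib matrix_vector_mul_assoc BA matrix_vector_mult_axis_nth
           expo_vec_def vec_eq_iff)
  qed
  then have diff: "of_nat (Poly_Mapping.lookup (\<alpha> i) k) - of_nat (Poly_Mapping.lookup (\<alpha> j) k) =
      ?B $ k $ i - ?B $ k $ j" for i j k
    by (simp add: algebra_simps)

  have "\<exists>m. inverse_exponent v i k = of_nat m" for i k
  proof -
    \<comment> \<open>The row minimum is attained at some column \<open>j\<close>, so the exponent
      is a difference of entries of \<open>\<alpha> i\<close> and \<open>\<alpha> j\<close>;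
      minimality makes the truncated subtraction below exact.\<close>
    have "row_min v k \<in> range (\<lambda>j. ?B $ k $ j)" "row_min v k \<le> ?B $ k $ i"
      unfolding row_min_def by (auto intro: Min_in)
    then obtain j where j: "row_min v k = ?B $ k $ j" "?B $ k $ j \<le> ?B $ k $ i"
      by auto
    then have "(of_nat (Poly_Mapping.lookup (\<alpha> j) k) :: rat) \<le> of_nat (Poly_Mapping.lookup (\<alpha> i) k)"
      using diff[of i k j] by linarith
    then have "inverse_exponent v i k = of_nat (Poly_Mapping.lookup (\<alpha> i) k - Poly_Mapping.lookup (\<alpha> j) k)"
      using diff[of i k j] j by (simp add: inverse_exponent_def of_nat_diff)
    then show ?thesis ..
  qed
  then obtain b where b: "\<And>i k. inverse_exponent v i k = of_nat (b i k)"
    by metis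
  \<comment> \<open>Every function on a finite type has finite support, so \<open>b i\<close> is an
    exponent.\<close>
  define \<beta> where "\<beta> i = Poly_Mapping.Abs_poly_mapping (b i)" for i
  have \<beta>: "of_nat (Poly_Mapping.lookup (\<beta> i) k) = ?B $ k $ i - row_min v k" for i k
    using b[of i k] by (simp add: \<beta>_def inverse_exponent_def)
  let ?y = "\<lambda>i. monomial (\<beta> i) :: ('n, 'k) mpoly"

  \<comment> \<open>Degree of the new monomials\<close>
  have "(\<Sum>k\<in>UNIV. ?B $ k $ i) = 1 / of_nat d" for i
  proof -
    \<comment> \<open>Here \<open>1\<close> is the all-ones vector, and pairing with it sums
      coordinates.\<close>
    have "transpose ?A *v 1 = (\<chi> i. of_nat d)"
      using sum_log_matrix_column[OF degree]
      by (simp add: matrix_vector_mult_def transpose_def vec_eq_iff)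
    then have "(\<Sum>k\<in>UNIV. (?A *v column i ?B) $ k) = of_nat d * (\<Sum>k\<in>UNIV. ?B $ k $ i)"
      using sum_mult_matrix_vector[of 1 ?A "column i ?B"]
      by (simp add: column_def sum_distrib_left)
    moreover have "?A *v column i ?B = axis i 1"
    proof -
      have "column i ?B = ?B *v axis i 1"
        by (simp add: column_def vec_eq_iff matrix_vector_mult_axis_nth)
      then show ?thesis
        by (simp add: matrix_vector_mul_assoc AB)
    qed
    ultimately show ?thesis
      using d_pos by (simp add: axis_def field_simps)
  qed
  then have deg_\<beta>: "of_nat (mono_deg (\<beta> i)) = inverse_degree v d" for i
    by (simp add: mono_deg_def \<beta> sum_subtractf inverse_degree_def)
  \<comment> \<open>\<open>undefined\<close> is merely some index at which to read off the common
    degree.\<close>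
  then have \<beta>_form: "\<forall>i. mono_deg (\<beta> i) = mono_deg (\<beta> undefined)"
    by (metis of_nat_eq_iff)

  \<comment> \<open>Exponents of the two composites\<close>
  have shift_v: "expo_subst v (\<beta> i) + Poly_Mapping.single j 1 =
      expo_subst v (\<beta> j) + Poly_Mapping.single i 1" for i j
  proof -
    \<comment> \<open>All columns of \<open>?B\<close> are shifted by the same vector of row minima,
      so their images under \<open>?A\<close> also share one shift.\<close>
    have "?A *v expo_vec (\<beta> i) = axis i 1 - ?A *v (\<chi> k. row_min v k)" for i
    proof -
      have "expo_vec (\<beta> i) = ?B *v axis i 1 - (\<chi> k. row_min v k)"
        by (simp add: expo_vec_def vec_eq_iff \<beta> matrix_vector_mult_axis_nth)
      then show ?thesis
        by (simp add: matrix_vector_mult_diff_distrib matrix_vector_mul_assoc AB)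
    qed
    then have "expo_vec (expo_subst v (\<beta> i) + Poly_Mapping.single j 1) =
        expo_vec (expo_subst v (\<beta> j) + Poly_Mapping.single i 1)"
      by (simp add: expo_vec_add expo_vec_single expo_vec_expo_subst)
    then show ?thesis
      by (simp add: expo_vec_eq_iff)
  qed

  have shift_\<beta>: "expo_subst \<beta> (v i) + Poly_Mapping.single j 1 =
      expo_subst \<beta> (v j) + Poly_Mapping.single i 1" for i j
  proof -
    \<comment> \<open>In this order the shift is independent of \<open>i\<close> because all columns
      of \<open>?A\<close> have the same sum \<open>d\<close>.\<close>
    have "expo_vec (expo_subst \<beta> (v i)) $ k = axis i 1 $ k - of_nat d * row_min v k" for i k
    proof -
      have "expo_vec (expo_subst \<beta> (v i)) $ k =
          (\<Sum>l\<in>UNIV. (?B $ k $ l - row_min v k) * ?A $ l $ i)"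
        by (simp add: expo_vec_def lookup_expo_subst \<beta> log_matrix_def mult.commute)
      also have "\<dots> = (?B ** ?A) $ k $ i - row_min v k * (\<Sum>l\<in>UNIV. ?A $ l $ i)"
        by (simp add: matrix_matrix_mult_def left_diff_distrib sum_subtractf sum_distrib_left)
      finally show ?thesis
        by (simp add: BA mat_def axis_def sum_log_matrix_column[OF degree])
    qed
    then have "expo_vec (expo_subst \<beta> (v i) + Poly_Mapping.single j 1) =
        expo_vec (expo_subst \<beta> (v j) + Poly_Mapping.single i 1)"
      by (simp add: expo_vec_add expo_vec_single vec_eq_iff)
    then show ?thesis
      by (simp add: expo_vec_eq_iff)
  qed

  \<comment> \<open>The monomial inverse\<close>
  have x_form: "form_tuple ?x" and y_form: "form_tuple ?y"
    using form_tuple_monomial degree \<beta>_form by blast+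
  have "composes_to (rat_map_of ?y) F id_map"
    unfolding composes_to_def F
    by (intro bexI[of _ ?y] bexI[of _ ?x])
      (simp_all add: subst_monomials_monomial monomial_map_eq_id[OF shift_v]
        rat_map_of_def[of ?x] rat_map_of_def[of ?y] same_map_refl x_form y_form)
  moreover have "composes_to F (rat_map_of ?y) id_map"
    unfolding composes_to_def F
    by (intro bexI[of _ ?x] bexI[of _ ?y])
      (simp_all add: subst_monomials_monomial monomial_map_eq_id[OF shift_\<beta>]
        rat_map_of_def[of ?x] rat_map_of_def[of ?y] same_map_refl x_form y_form)
  ultimately have inverse: "is_inverse F (rat_map_of ?y)"
    using x_form y_form by (auto simp: is_inverse_def is_rat_map_def F)

  \<comment> \<open>Uniqueness of the inverse\<close>
  have unique: "G = rat_map_of ?y" if "is_inverse F G" for G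
  proof -
    from that have "is_rat_map G" "composes_to G (rat_map_of ?x) id_map"
      by (auto simp: is_inverse_def F)
    then obtain g where G: "G = rat_map_of g" "form_tuple g"
      and minors: "\<And>i j. subst ?x (g i) * X j = subst ?x (g j) * X i"
      by (rule composes_to_id_representative) blast
    text \<open>Substituting \<open>x\<^sup>v\<close> preserves coefficients, so the minors may be compared after it.\<close>
    have "g i * ?y j = g j * ?y i" for i j
    proof (rule subst_monomials_injD[OF inj_expo_subst[OF inv]])
      let ?w = "\<lambda>i. monomial (expo_subst v (\<beta> i)) :: ('n, 'k) mpoly"
      have "?w j * X i = ?w i * X j"
        by (metis X_def monomial_add shift_v)
      \<comment> \<open>Multiplying the minor relations of \<open>g\<close> and of the monomial
        inverse produces the common factor \<open>X i * X j\<close>, which then cancels.\<close>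
      then have "(subst ?x (g i) * X j) * (?w j * X i) = (subst ?x (g j) * X i) * (?w i * X j)"
        by (simp only: minors[of i j])
      then have "X i * X j * (subst ?x (g i) * ?w j) = X i * X j * (subst ?x (g j) * ?w i)"
        by (simp only: ac_simps)
      then show "subst ?x (g i * ?y j) = subst ?x (g j * ?y i)"
        unfolding subst_monomials_mult_monomial
        by (rule mpoly_mult_left_cancel[OF mpoly_no_zero_divisors[OF X_nonzero X_nonzero]])
    qed
    then show ?thesis
      unfolding G(1) using G(2) y_form by (intro rat_map_of_eqI same_map_of_minors) auto
  qed

  show ?thesis
  proof (intro conjI exI allI)
    show "invertible ?A"
      by (rule inv)
    show "mono_deg (\<beta> i) = mono_deg (\<beta> undefined)" for i
      using \<beta>_form by blast
    show "is_inverse F G \<longleftrightarrow> G = rat_map_of ?y" for G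
      using inverse unique by blast
    show "of_nat (Poly_Mapping.lookup (\<beta> i) k) = inverse_exponent v i k" for i k
      by (simp add: \<beta> inverse_exponent_def)
    show "of_nat (mono_deg (\<beta> undefined)) = inverse_degree v d"
      by (rule deg_\<beta>)
  qed
qed

end
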